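(* Let $G$ be an Abelian group and $S$ a subsemigroup of $G$ with $0\in S$. The following conditions are equivalent: (1) the space $G_{\vec S}$ is compact; (2) the space $G_{\vec S}$ is $\omega$-bounded; (3) the space $G_{\vec S}$ is totally countably compact; (4) the space $G_{\vec S}$ is sequentially compact; (5) the space $G_{\vec S}$ is countably compact; (6) the paratopological group $G_{\vec S}$ is precompact; (7) the semigroup $S$ is a subgroup of finite index in $G$.
   Context: For an Abelian group $G$ (written additively) and a subsemigroup $S\ni 0$ of $G$, $G_{\vec S}$ denotes the group $G$ endowed with the topology consisting of all sets $U\subseteq G$ such that for every $u\in U$ there exists $x\in S$ with $u+x+S\subseteq U$; it is a paratopological group (addition is continuous). A space $X$ is $\omega$-bounded if each countable subset of $X$ has compact closure; totally countably compact if each sequence in $X$ contains a subsequence whose set of terms has compact closure; sequentially compact if each sequence in $X$ has a convergent subsequence; countably compact if each infinite $B\subseteq X$ has an accumulation point $x\in X$ (each neighborhood of $x$ contains infinitely many points of $B$). Compactness means every open cover has a finite subcover; no separation axioms are assumed. A paratopological group $G$ (written additively) is precompact if for each neighborhood $U$ of the identity there is a finite $F\subseteq G$ with $F+U=G$. *)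

theory Defs
  imports "HOL-Analysis.Analysis" "HOL-Algebra.Coset"
begin

text \<open>
  Groups are those of HOL-Algebra, hence written multiplicatively: the sum of the additive notation
  is the group multiplication, its \<open>0\<close> is \<open>\<one>\<close>, and its \<open>u + x + S\<close> is the left coset of \<open>S\<close> through \<open>u \<otimes> x\<close>.  A subsemigroup containing the identity is a \<^locale>\<open>submonoid\<close>.
\<close>

definition shift_topology :: "('a, 'b) monoid_scheme \<Rightarrow> 'a set \<Rightarrow> 'a topology" where
  "shift_topology G S =
     topology (\<lambda>U. U \<subseteq> carrier G \<and> (\<forall>u\<in>U. \<exists>x\<in>S. (u \<otimes>\<^bsub>G\<^esub> x) <#\<^bsub>G\<^esub> S \<subseteq> U))"

definition paratopological_group :: "('a, 'b) monoid_scheme \<Rightarrow> 'a topology \<Rightarrow> bool" where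
  "paratopological_group G T \<longleftrightarrow>
     group G \<and> topspace T = carrier G \<and>
     continuous_map (prod_topology T T) T (\<lambda>(x, y). x \<otimes>\<^bsub>G\<^esub> y)"

text \<open>Neighbourhoods need not be open.\<close>

definition neighbourhood_in :: "'a topology \<Rightarrow> 'a \<Rightarrow> 'a set \<Rightarrow> bool" where
  "neighbourhood_in T x U \<longleftrightarrow> U \<subseteq> topspace T \<and> (\<exists>V. openin T V \<and> x \<in> V \<and> V \<subseteq> U)"

definition omega_bounded_space :: "'a topology \<Rightarrow> bool" where
  "omega_bounded_space T \<longleftrightarrow>
     (\<forall>A. A \<subseteq> topspace T \<and> countable A \<longrightarrow> compactin T (T closure_of A))"

definition totally_countably_compact_space :: "'a topology \<Rightarrow> bool" where
  "totally_countably_compact_space T \<longleftrightarrow>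
     (\<forall>\<sigma> :: nat \<Rightarrow> 'a. range \<sigma> \<subseteq> topspace T \<longrightarrow>
        (\<exists>r :: nat \<Rightarrow> nat. strict_mono r \<and> compactin T (T closure_of (range (\<sigma> \<circ> r)))))"

definition sequentially_compact_space :: "'a topology \<Rightarrow> bool" where
  "sequentially_compact_space T \<longleftrightarrow>
     (\<forall>\<sigma> :: nat \<Rightarrow> 'a. range \<sigma> \<subseteq> topspace T \<longrightarrow>
        (\<exists>(r :: nat \<Rightarrow> nat) l. strict_mono r \<and> limitin T (\<sigma> \<circ> r) l sequentially))"

text \<open>
  No separation is assumed, so an accumulation point in the sense below is a stronger notion
  than a member of the derived set of the library (\<^const>\<open>derived_set_of\<close>).
\<close>

definition countably_compact_space :: "'a topology \<Rightarrow> bool" where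
  "countably_compact_space T \<longleftrightarrow>
     (\<forall>B. B \<subseteq> topspace T \<and> infinite B \<longrightarrow>
        (\<exists>x\<in>topspace T. \<forall>U. neighbourhood_in T x U \<longrightarrow> infinite (U \<inter> B)))"

definition precompact_group :: "('a, 'b) monoid_scheme \<Rightarrow> 'a topology \<Rightarrow> bool" where
  "precompact_group G T \<longleftrightarrow>
     (\<forall>U. neighbourhood_in T \<one>\<^bsub>G\<^esub> U \<longrightarrow>
        (\<exists>F. finite F \<and> F \<subseteq> carrier G \<and> F <#>\<^bsub>G\<^esub> U = carrier G))"

definition finite_index_subgroup :: "'a set \<Rightarrow> ('a, 'b) monoid_scheme \<Rightarrow> bool" where
  "finite_index_subgroup H G \<longleftrightarrow> subgroup H G \<and> finite (rcosets\<^bsub>G\<^esub> H)"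

lemma openin_shift_topology:
  fixes G (structure)
  assumes "comm_group G" and "submonoid S G"
  shows "openin (shift_topology G S) U \<longleftrightarrow>
           U \<subseteq> carrier G \<and> (\<forall>u\<in>U. \<exists>x\<in>S. (u \<otimes>\<^bsub>G\<^esub> x) <#\<^bsub>G\<^esub> S \<subseteq> U)"
proof -
  interpret comm_group G by fact
  interpret S: submonoid S G by fact
  let ?P = "\<lambda>U. U \<subseteq> carrier G \<and> (\<forall>u\<in>U. \<exists>x\<in>S. (u \<otimes>\<^bsub>G\<^esub> x) <#\<^bsub>G\<^esub> S \<subseteq> U)"
  have sub: "(u \<otimes> (x \<otimes> y)) <#\<^bsub>G\<^esub> S \<subseteq> (u \<otimes> x) <#\<^bsub>G\<^esub> S" if "u \<in> carrier G" "x \<in> S" "y \<in> S" for u x y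
  proof
    fix z assume "z \<in> (u \<otimes> (x \<otimes> y)) <#\<^bsub>G\<^esub> S"
    then obtain s where s: "s \<in> S" "z = (u \<otimes> (x \<otimes> y)) \<otimes> s" by (auto simp: l_coset_def)
    then have "z = (u \<otimes> x) \<otimes> (y \<otimes> s)" using that by (simp add: m_assoc)
    then show "z \<in> (u \<otimes> x) <#\<^bsub>G\<^esub> S" using that s by (auto simp: l_coset_def)
  qed
  have "istopology ?P"
    unfolding istopology_def
  proof (intro conjI allI impI)
    fix U V assume U: "?P U" and V: "?P V"
    show "U \<inter> V \<subseteq> carrier G" using U by blast
    show "\<forall>u\<in>U \<inter> V. \<exists>x\<in>S. (u \<otimes> x) <#\<^bsub>G\<^esub> S \<subseteq> U \<inter> V"
    proof
      fix u assume u: "u \<in> U \<inter> V"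
      obtain x y where x: "x \<in> S" "(u \<otimes> x) <#\<^bsub>G\<^esub> S \<subseteq> U" and y: "y \<in> S" "(u \<otimes> y) <#\<^bsub>G\<^esub> S \<subseteq> V"
        using u U V by blast
      have uc: "u \<in> carrier G" using u U by blast
      have "(u \<otimes> (x \<otimes> y)) <#\<^bsub>G\<^esub> S \<subseteq> U" using sub[OF uc x(1) y(1)] x(2) by blast
      moreover have "(u \<otimes> (x \<otimes> y)) <#\<^bsub>G\<^esub> S \<subseteq> V"
        using sub[OF uc y(1) x(1)] y(2) x(1) y(1) by (simp add: m_comm)
      ultimately show "\<exists>x\<in>S. (u \<otimes> x) <#\<^bsub>G\<^esub> S \<subseteq> U \<inter> V" using x(1) y(1) by blast
    qed
  next
    fix K assume "\<forall>U\<in>K. ?P U"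
    then show "\<Union>K \<subseteq> carrier G" by blast
  next
    fix K assume K: "\<forall>U\<in>K. ?P U"
    show "\<forall>u\<in>\<Union>K. \<exists>x\<in>S. (u \<otimes> x) <#\<^bsub>G\<^esub> S \<subseteq> \<Union>K"
    proof
      fix u assume "u \<in> \<Union>K"
      then obtain U where "U \<in> K" "u \<in> U" by blast
      with K obtain x where "x \<in> S" "(u \<otimes> x) <#\<^bsub>G\<^esub> S \<subseteq> U" by blast
      then show "\<exists>x\<in>S. (u \<otimes> x) <#\<^bsub>G\<^esub> S \<subseteq> \<Union>K" using \<open>U \<in> K\<close> by blast
    qed
  qed
  then show ?thesis by (simp add: shift_topology_def topology_inverse')
qed

lemma topspace_shift_topology:
  fixes G (structure)
  assumes "comm_group G" and "submonoid S G"
  shows "topspace (shift_topology G S) = carrier G"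
proof -
  interpret comm_group G by fact
  interpret S: submonoid S G by fact
  have "openin (shift_topology G S) (carrier G)"
    unfolding openin_shift_topology[OF assms]
    using S.one_closed by (auto simp: l_coset_def intro!: bexI[of _ \<one>])
  moreover have "topspace (shift_topology G S) \<subseteq> carrier G"
    using openin_shift_topology[OF assms] openin_topspace by blast
  ultimately show ?thesis using openin_subset by blast
qed

lemma paratopological_group_shift_topology:
  fixes G (structure)
  assumes "comm_group G" and "submonoid S G"
  shows "paratopological_group G (shift_topology G S)"
proof -
  interpret comm_group G by fact
  interpret S: submonoid S G by fact
  let ?T = "shift_topology G S"
  note [simp] = topspace_shift_topology[OF assms]
  note op = openin_shift_topology[OF assms]
  have basic: "openin ?T (insert u ((u \<otimes> x) <#\<^bsub>G\<^esub> S))" if u: "u \<in> carrier G" and x: "x \<in> S" for u x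
    unfolding op
  proof (intro conjI ballI)
    show "insert u ((u \<otimes> x) <#\<^bsub>G\<^esub> S) \<subseteq> carrier G"
      using u x by (auto simp: l_coset_def)
    fix v assume "v \<in> insert u ((u \<otimes> x) <#\<^bsub>G\<^esub> S)"
    then consider "v = u" | s where "s \<in> S" "v = (u \<otimes> x) \<otimes> s" by (auto simp: l_coset_def)
    then show "\<exists>y\<in>S. (v \<otimes> y) <#\<^bsub>G\<^esub> S \<subseteq> insert u ((u \<otimes> x) <#\<^bsub>G\<^esub> S)"
    proof cases
      case 1 then show ?thesis using x by blast
    next
      case 2
      have "(v \<otimes> \<one>) <#\<^bsub>G\<^esub> S \<subseteq> (u \<otimes> x) <#\<^bsub>G\<^esub> S"
      proof
        fix z assume "z \<in> (v \<otimes> \<one>) <#\<^bsub>G\<^esub> S"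
        then obtain t where t: "t \<in> S" "z = (v \<otimes> \<one>) \<otimes> t" by (auto simp: l_coset_def)
        then have "z = (u \<otimes> x) \<otimes> (s \<otimes> t)" using 2 u x by (simp add: m_assoc)
        then show "z \<in> (u \<otimes> x) <#\<^bsub>G\<^esub> S" using 2 t by (auto simp: l_coset_def)
      qed
      then show ?thesis using S.one_closed by blast
    qed
  qed
  have "continuous_map (prod_topology ?T ?T) ?T (\<lambda>(x, y). x \<otimes> y)"
    unfolding continuous_map_def
  proof (intro conjI allI impI)
    show "(\<lambda>(x, y). x \<otimes> y) \<in> topspace (prod_topology ?T ?T) \<rightarrow> topspace ?T" by auto
    fix U assume U: "openin ?T U"
    show "openin (prod_topology ?T ?T)
            {p \<in> topspace (prod_topology ?T ?T). (case p of (x, y) \<Rightarrow> x \<otimes> y) \<in> U}"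
      unfolding openin_prod_topology_alt
    proof (intro allI impI)
      fix a b
      assume "(a, b) \<in> {p \<in> topspace (prod_topology ?T ?T). (case p of (x, y) \<Rightarrow> x \<otimes> y) \<in> U}"
      then have a: "a \<in> carrier G" and b: "b \<in> carrier G" and ab: "a \<otimes> b \<in> U" by auto
      obtain x where x: "x \<in> S" and xU: "((a \<otimes> b) \<otimes> x) <#\<^bsub>G\<^esub> S \<subseteq> U" using U ab by (auto simp: op)
      let ?A = "insert a ((a \<otimes> x) <#\<^bsub>G\<^esub> S)" and ?B = "insert b ((b \<otimes> x) <#\<^bsub>G\<^esub> S)"
      have inU: "(a \<otimes> b) \<otimes> x \<otimes> s \<in> U" if "s \<in> S" for s
        using xU that by (auto simp: l_coset_def)
      have xc: "x \<in> carrier G" using x by simp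
      have "p \<otimes> q \<in> U" if p: "p \<in> ?A" and q: "q \<in> ?B" for p q
      proof -
        consider "p = a" "q = b"
          | t where "p = a" "t \<in> S" "q = (b \<otimes> x) \<otimes> t"
          | s where "s \<in> S" "p = (a \<otimes> x) \<otimes> s" "q = b"
          | s t where "s \<in> S" "p = (a \<otimes> x) \<otimes> s" "t \<in> S" "q = (b \<otimes> x) \<otimes> t"
          using p q by (auto simp: l_coset_def)
        then show ?thesis
        proof cases
          case 1 then show ?thesis using ab by simp
        next
          case (2 t)
          then have "p \<otimes> q = (a \<otimes> b) \<otimes> x \<otimes> t" using a b xc by (simp add: m_ac)
          then show ?thesis using inU 2 by simp
        next
          case (3 s)
          then have "p \<otimes> q = (a \<otimes> b) \<otimes> x \<otimes> s" using a b xc by (simp add: m_ac)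
          then show ?thesis using inU 3 by simp
        next
          case (4 s t)
          then have "p \<otimes> q = (a \<otimes> b) \<otimes> x \<otimes> (x \<otimes> s \<otimes> t)" using a b xc by (simp add: m_ac)
          then show ?thesis using inU[of "x \<otimes> s \<otimes> t"] 4 x by simp
        qed
      qed
      moreover have "openin ?T ?A" "openin ?T ?B" using basic a b x by auto
      moreover have "?A \<subseteq> carrier G" "?B \<subseteq> carrier G"
        using calculation(2,3) openin_subset by fastforce+
      ultimately show "\<exists>V W. openin ?T V \<and> openin ?T W \<and> a \<in> V \<and> b \<in> W \<and>
          V \<times> W \<subseteq> {p \<in> topspace (prod_topology ?T ?T). (case p of (x, y) \<Rightarrow> x \<otimes> y) \<in> U}"
        by (intro exI[of _ ?A] exI[of _ ?B]) auto
    qed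
  qed
  then show ?thesis by (simp add: paratopological_group_def is_group)
qed

end

theory Submission
  imports Defs
begin

text \<open>
  If \<open>S\<close> is a subgroup of finite index, then the open sets are unions of cosets of \<open>S\<close>, so there are
  only finitely many of them and all the compactness conditions hold.  Conditions (1)--(4) each imply
  countable compactness.  If the space is countably compact and \<open>s \<in> S\<close> has infinite order, let \<open>x\<close> be
  an accumulation point of the powers of \<open>s\<^sup>-\<^sup>1\<close>.  The neighbourhood of \<open>x\<close> generated by the shift
  \<open>\<one>\<close> shows \<open>x\<^sup>-\<^sup>1 \<in> S\<close>, and then the one generated by the shift \<open>x\<^sup>-\<^sup>1\<close> gives \<open>s\<^sup>-\<^sup>1 \<in> S\<close>; so \<open>S\<close> is a
  subgroup, and a set of representatives of its cosets, having no accumulation point, is finite.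
  If the group is precompact, then \<open>F S = G\<close> with \<open>F\<close> finite, because \<open>S\<close> is open; clearing the
  denominators of the elements of \<open>F\<close> that are fractions over \<open>S\<close> shows that every fraction lies in \<open>S\<close>.
\<close>

section \<open>General relations between the compactness conditions\<close>

lemma neighbourhood_in_openin:
  "openin T V \<Longrightarrow> x \<in> V \<Longrightarrow> neighbourhood_in T x V"
  unfolding neighbourhood_in_def using openin_subset by blast

lemma compact_space_imp_omega_bounded_space:
  "compact_space T \<Longrightarrow> omega_bounded_space T"
  unfolding omega_bounded_space_def using closedin_compact_space closedin_closure_of by blast

lemma omega_bounded_space_imp_totally_countably_compact_space:
  assumes "omega_bounded_space T"
  shows "totally_countably_compact_space T"
  unfolding totally_countably_compact_space_def
proof (intro allI impI)
  fix \<sigma> :: "nat \<Rightarrow> 'a"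
  assume "range \<sigma> \<subseteq> topspace T"
  then have "compactin T (T closure_of range (\<sigma> \<circ> id))"
    using assms by (simp add: omega_bounded_space_def)
  then show "\<exists>r :: nat \<Rightarrow> nat. strict_mono r \<and> compactin T (T closure_of range (\<sigma> \<circ> r))"
    using strict_mono_id by metis
qed

lemma compactin_imp_accumulation_point:
  assumes K: "compactin T K" and A: "A \<subseteq> K" "infinite A"
  shows "\<exists>x\<in>K. \<forall>U. neighbourhood_in T x U \<longrightarrow> infinite (U \<inter> A)"
proof (rule ccontr)
  assume neg: "\<not> ?thesis"
  have "\<exists>V. openin T V \<and> x \<in> V \<and> finite (V \<inter> A)" if x: "x \<in> K" for x
  proof -
    obtain U where U: "neighbourhood_in T x U" "finite (U \<inter> A)" using neg x by blast
    then obtain V where "openin T V" "x \<in> V" "V \<subseteq> U" unfolding neighbourhood_in_def by blast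
    moreover have "finite (V \<inter> A)"
      by (rule finite_subset[OF _ U(2)]) (use \<open>V \<subseteq> U\<close> in blast)
    ultimately show ?thesis by blast
  qed
  then have "K \<subseteq> \<Union>{V. openin T V \<and> finite (V \<inter> A)}" by blast
  then obtain \<F> where \<F>: "finite \<F>" "\<F> \<subseteq> {V. openin T V \<and> finite (V \<inter> A)}" "K \<subseteq> \<Union>\<F>"
    using K unfolding compactin_def by (metis (no_types, lifting) mem_Collect_eq)
  have "finite (\<Union>V\<in>\<F>. V \<inter> A)" using \<F>(1,2) by blast
  moreover have "A \<subseteq> (\<Union>V\<in>\<F>. V \<inter> A)" using A(1) \<F>(3) by blast
  ultimately show False using A(2) finite_subset by blast
qed

text \<open>Enumerate part of \<open>B\<close> without repetition. Some subsequence has infinitely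
  many terms inside a compact closure, and an accumulation point of these terms is one of
  \<open>B\<close>.\<close>

lemma totally_countably_compact_space_imp_countably_compact_space:
  assumes "totally_countably_compact_space T"
  shows "countably_compact_space T"
  unfolding countably_compact_space_def
proof (intro allI impI, elim conjE)
  fix B assume B: "B \<subseteq> topspace T" "infinite B"
  obtain \<sigma> :: "nat \<Rightarrow> 'a" where \<sigma>: "inj \<sigma>" "range \<sigma> \<subseteq> B"
    using B(2) infinite_countable_subset by blast
  obtain r :: "nat \<Rightarrow> nat" where r: "strict_mono r" "compactin T (T closure_of range (\<sigma> \<circ> r))"
    using assms \<sigma>(2) B(1) unfolding totally_countably_compact_space_def by (meson subset_trans)
  have sub: "range (\<sigma> \<circ> r) \<subseteq> B" using \<sigma>(2) by auto
  have "inj (\<sigma> \<circ> r)" using \<sigma>(1) r(1) by (simp add: inj_compose strict_mono_imp_inj_on)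
  then have inf: "infinite (range (\<sigma> \<circ> r))" using finite_imageD by blast
  have "range (\<sigma> \<circ> r) \<subseteq> T closure_of range (\<sigma> \<circ> r)"
    using sub B(1) by (intro closure_of_subset) blast
  from compactin_imp_accumulation_point[OF r(2) this inf]
  obtain x where x: "x \<in> T closure_of range (\<sigma> \<circ> r)"
    and acc: "\<And>U. neighbourhood_in T x U \<Longrightarrow> infinite (U \<inter> range (\<sigma> \<circ> r))" by blast
  have "infinite (U \<inter> B)" if "neighbourhood_in T x U" for U
    using acc[OF that] sub by (meson Int_mono finite_subset order_refl)
  then show "\<exists>x\<in>topspace T. \<forall>U. neighbourhood_in T x U \<longrightarrow> infinite (U \<inter> B)"
    using x by (meson closure_of_subset_topspace subsetD)
qed

text \<open>The limit of a subsequence of distinct points of \<open>B\<close> works: every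
  neighbourhood of it contains a tail, which is infinite by injectivity.\<close>

lemma sequentially_compact_space_imp_countably_compact_space:
  assumes "sequentially_compact_space T"
  shows "countably_compact_space T"
  unfolding countably_compact_space_def
proof (intro allI impI, elim conjE)
  fix B assume B: "B \<subseteq> topspace T" "infinite B"
  obtain \<sigma> :: "nat \<Rightarrow> 'a" where \<sigma>: "inj \<sigma>" "range \<sigma> \<subseteq> B"
    using B(2) infinite_countable_subset by blast
  obtain r :: "nat \<Rightarrow> nat" and l where r: "strict_mono r" "limitin T (\<sigma> \<circ> r) l sequentially"
    using assms \<sigma>(2) B(1) unfolding sequentially_compact_space_def by (meson subset_trans)
  have inj: "inj (\<sigma> \<circ> r)" using \<sigma>(1) r(1) by (simp add: inj_compose strict_mono_imp_inj_on)
  have "infinite (U \<inter> B)" if U: "neighbourhood_in T l U" for U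
  proof -
    obtain V where V: "openin T V" "l \<in> V" "V \<subseteq> U"
      using U unfolding neighbourhood_in_def by blast
    then obtain N where N: "\<And>n. n \<ge> N \<Longrightarrow> (\<sigma> \<circ> r) n \<in> V"
      using r(2) unfolding limitin_sequentially by blast
    have "infinite ((\<sigma> \<circ> r) ` {N..})"
      using finite_image_iff[OF inj_on_subset[OF inj subset_UNIV]] infinite_Ici by blast
    moreover have "(\<sigma> \<circ> r) ` {N..} \<subseteq> U \<inter> B" using N V(3) \<sigma>(2) by auto
    ultimately show ?thesis using finite_subset by blast
  qed
  moreover have "l \<in> topspace T" using limitin_topspace[OF r(2)] .
  ultimately show "\<exists>x\<in>topspace T. \<forall>U. neighbourhood_in T x U \<longrightarrow> infinite (U \<inter> B)" by blast
qed

lemma finite_opens_imp_compact_space: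
  assumes "finite {U. openin T U}"
  shows "compact_space T"
  unfolding compact_space_def compactin_def
proof (intro conjI allI impI)
  fix \<U> assume \<U>: "Ball \<U> (openin T) \<and> topspace T \<subseteq> \<Union>\<U>"
  then have "finite \<U>" by (intro finite_subset[OF _ assms]) blast
  then show "\<exists>\<F>. finite \<F> \<and> \<F> \<subseteq> \<U> \<and> topspace T \<subseteq> \<Union>\<F>" using \<U> by blast
qed simp

section \<open>Cosets of \<open>S\<close> and the open sets of the shift topology\<close>

locale shift_space = comm_group G + S: submonoid S G for G (structure) and S
begin

abbreviation T where "T \<equiv> shift_topology G S"

lemma topspace_T [simp]: "topspace T = carrier G"
  by (intro topspace_shift_topology comm_group_axioms S.submonoid_axioms)

lemma openin_T:
  "openin T U \<longleftrightarrow> U \<subseteq> carrier G \<and> (\<forall>u\<in>U. \<exists>x\<in>S. (u \<otimes> x) <# S \<subseteq> U)"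
  by (intro openin_shift_topology comm_group_axioms S.submonoid_axioms)

lemma mem_l_coset_iff:
  assumes "u \<in> carrier G"
  shows "z \<in> u <# S \<longleftrightarrow> z \<in> carrier G \<and> inv u \<otimes> z \<in> S"
proof
  assume "z \<in> u <# S"
  then obtain s where "s \<in> S" "z = u \<otimes> s" by (auto simp: l_coset_def)
  then show "z \<in> carrier G \<and> inv u \<otimes> z \<in> S" using assms by (simp flip: m_assoc)
next
  assume "z \<in> carrier G \<and> inv u \<otimes> z \<in> S"
  moreover from this have "z = u \<otimes> (inv u \<otimes> z)" using assms by (simp flip: m_assoc)
  ultimately show "z \<in> u <# S" unfolding l_coset_def by blast
qed

text \<open>Closure of \<open>S\<close> under multiplication gives one inclusion only; equality
  would require inverses in \<open>S\<close>.\<close>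

lemma l_coset_absorb:
  assumes "u \<in> carrier G" "v \<in> u <# S"
  shows "v <# S \<subseteq> u <# S"
proof
  fix z assume "z \<in> v <# S"
  then obtain t where t: "t \<in> S" "z = v \<otimes> t" by (auto simp: l_coset_def)
  obtain s where s: "s \<in> S" "v = u \<otimes> s" using assms(2) by (auto simp: l_coset_def)
  have "z = u \<otimes> (s \<otimes> t)" using s t assms(1) by (simp add: m_assoc)
  then show "z \<in> u <# S" using s(1) t(1) by (auto simp: l_coset_def)
qed

text \<open>These sets form a neighbourhood base at \<open>u\<close>. The point is inserted because
  \<open>u\<close> need not lie in its shifted coset. At \<open>u\<close> the shift \<open>x\<close>
  works, at any other point the shift \<open>\<one>\<close>.\<close>

lemma openin_insert_l_coset:
  assumes u: "u \<in> carrier G" and x: "x \<in> S"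
  shows "openin T (insert u ((u \<otimes> x) <# S))"
  unfolding openin_T
proof (intro conjI ballI)
  have ux: "u \<otimes> x \<in> carrier G" using u x by simp
  show "insert u ((u \<otimes> x) <# S) \<subseteq> carrier G" using u ux by (auto simp: mem_l_coset_iff)
  fix v assume "v \<in> insert u ((u \<otimes> x) <# S)"
  then consider "v = u" | "v \<in> (u \<otimes> x) <# S" by blast
  then show "\<exists>y\<in>S. (v \<otimes> y) <# S \<subseteq> insert u ((u \<otimes> x) <# S)"
  proof cases
    case 1
    then show ?thesis using x by blast
  next
    case 2
    then have "v \<otimes> \<one> = v" using ux by (simp add: mem_l_coset_iff)
    then show ?thesis using l_coset_absorb[OF ux 2] S.one_closed by (metis subset_insertI2)
  qed
qed

lemma openin_l_coset:
  assumes "u \<in> carrier G"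
  shows "openin T (u <# S)"
proof -
  have "u \<in> u <# S" using assms by (simp add: mem_l_coset_iff)
  then show ?thesis using openin_insert_l_coset[OF assms S.one_closed] assms
    by (simp add: insert_absorb)
qed

section \<open>From countable compactness to a subgroup of finite index\<close>

lemma subgroup_if_inv_closed:
  assumes "\<And>s. s \<in> S \<Longrightarrow> inv s \<in> S"
  shows "subgroup S G"
  by (rule subgroupI) (use S.subset S.one_closed assms in \<open>auto simp del: S.one_closed\<close>)

lemma pow_closed: "s \<in> S \<Longrightarrow> s [^] (n::nat) \<in> S"
  by (induction n) auto

text \<open>A single negative power of \<open>s\<close> in \<open>S\<close> suffices, because
  multiplying it by \<open>n - 1\<close> factors \<open>s\<close> leaves
  \<open>inv s\<close>.\<close>

lemma inv_mem_of_inv_pow_mem: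
  assumes s: "s \<in> S" and n: "n > 0" "inv (s [^] (n::nat)) \<in> S"
  shows "inv s \<in> S"
proof -
  obtain m where m: "n = Suc m" using n(1) gr0_implies_Suc by blast
  have c: "s \<in> carrier G" "s [^] m \<in> carrier G" using s by auto
  have "inv s = inv (s [^] n) \<otimes> s [^] m"
    using c unfolding m by (simp add: inv_mult m_ac)
  then show ?thesis using n(2) pow_closed[OF s] by simp
qed

lemma countably_compact_space_imp_inv_closed:
  assumes cc: "countably_compact_space T" and s: "s \<in> S"
  shows "inv s \<in> S"
proof -
  define f where "f n = inv (s [^] (n::nat))" for n
  have sc: "s \<in> carrier G" using s by simp
  show ?thesis
  proof (cases "inj f")
    \<comment> \<open>Two equal powers give \<open>s\<close> finite order, so some positive power is
      \<open>\<one>\<close>, which is its own inverse and lies in \<open>S\<close>.\<close>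
    case False
    then obtain m n where "m < n" "f m = f n"
      by (metis injI linorder_neqE_nat)
    then have "s [^] m = s [^] n" using sc by (metis f_def inv_inv nat_pow_closed)
    also have "\<dots> = s [^] m \<otimes> s [^] (n - m)" using \<open>m < n\<close> sc by (simp add: nat_pow_mult)
    finally have "s [^] (n - m) = \<one>" using sc by simp
    then have "inv (s [^] (n - m)) \<in> S" using S.one_closed by simp
    then show ?thesis using inv_mem_of_inv_pow_mem[OF s, of "n - m"] \<open>m < n\<close> by simp
  next
    case True
    have "range f \<subseteq> carrier G" using sc by (auto simp: f_def)
    moreover have "infinite (range f)" using True finite_imageD by blast
    ultimately obtain x where x: "x \<in> carrier G"
      and acc: "\<And>U. neighbourhood_in T x U \<Longrightarrow> infinite (U \<inter> range f)"
      using cc unfolding countably_compact_space_def by auto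
    have hit: "\<exists>n>0. f n \<in> (x \<otimes> y) <# S" if y: "y \<in> S" for y
    proof -
      have "infinite (insert x ((x \<otimes> y) <# S) \<inter> range f)"
        by (intro acc neighbourhood_in_openin openin_insert_l_coset x y insertI1)
      \<comment> \<open>Two points are discarded: \<open>x\<close>, which may lie outside the coset,
        and \<open>f 0\<close>, in order to force \<open>n > 0\<close>.\<close>
      then have "\<not> insert x ((x \<otimes> y) <# S) \<inter> range f \<subseteq> {x, f 0}"
        using finite_subset by blast
      then obtain n where "f n \<in> (x \<otimes> y) <# S" "f n \<noteq> f 0" by auto
      then show ?thesis by (metis gr0I)
    qed
    obtain n where "f n \<in> (x \<otimes> \<one>) <# S" using hit[OF S.one_closed] by blast
    then have "inv x \<otimes> f n \<in> S" using x by (simp add: mem_l_coset_iff)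
    \<comment> \<open>The factor \<open>s [^] n\<close> cancels \<open>f n\<close>, leaving
      \<open>inv x\<close>.\<close>
    then have "inv x \<otimes> f n \<otimes> s [^] n \<in> S" using pow_closed[OF s] by simp
    then have ix: "inv x \<in> S" using x sc by (simp add: f_def m_assoc)
    \<comment> \<open>Now \<open>inv x\<close> is itself an admissible shift, and it turns the coset
      into \<open>S\<close>.\<close>
    obtain n where "n > 0" "f n \<in> (x \<otimes> inv x) <# S" using hit[OF ix] by blast
    then have "\<one> \<otimes> f n \<in> S" "f n \<in> carrier G" using x by (auto simp: mem_l_coset_iff)
    then have "f n \<in> S" by simp
    then show ?thesis using inv_mem_of_inv_pow_mem[OF s \<open>n > 0\<close>] by (simp add: f_def)
  qed
qed

text \<open>Links the left cosets of the topology with the right cosets that define the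
  index.\<close>

lemma r_coset_eq_l_coset: "u \<in> carrier G \<Longrightarrow> S #> u = u <# S"
  by (auto simp: r_coset_def l_coset_def m_comm)

lemma countably_compact_space_imp_finite_index:
  assumes cc: "countably_compact_space T"
  shows "finite_index_subgroup S G"
proof -
  have sg: "subgroup S G"
    using countably_compact_space_imp_inv_closed[OF cc] by (rule subgroup_if_inv_closed)
  \<comment> \<open>\<open>c\<close> chooses one representative per coset. The open coset of any
    point contains just one of them, so an infinite set of representatives would have no
    accumulation point.\<close>
  define c where "c C = (SOME a. a \<in> carrier G \<and> S #> a = C)" for C
  have c: "c C \<in> carrier G \<and> S #> c C = C" if "C \<in> rcosets S" for C
    unfolding c_def by (rule someI_ex) (use that in \<open>auto simp: RCOSETS_def\<close>)
  have "finite (c ` (rcosets S))"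
  proof (rule ccontr)
    assume "infinite (c ` (rcosets S))"
    moreover have "c ` (rcosets S) \<subseteq> topspace T" using c by auto
    ultimately obtain x where x: "x \<in> carrier G"
      and acc: "\<And>U. neighbourhood_in T x U \<Longrightarrow> infinite (U \<inter> c ` (rcosets S))"
      using cc unfolding countably_compact_space_def by auto
    have "x \<in> x <# S" using x by (simp add: mem_l_coset_iff)
    then have "neighbourhood_in T x (x <# S)"
      by (rule neighbourhood_in_openin[OF openin_l_coset[OF x]])
    then have "infinite ((x <# S) \<inter> c ` (rcosets S))" by (rule acc)
    moreover have "(x <# S) \<inter> c ` (rcosets S) \<subseteq> {c (S #> x)}"
    proof
      fix b assume "b \<in> (x <# S) \<inter> c ` (rcosets S)"
      then obtain C where C: "C \<in> rcosets S" "b = c C" and "b \<in> S #> x"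
        using x r_coset_eq_l_coset by auto
      then have "S #> x = C" using repr_independence[OF _ x sg] c by metis
      then show "b \<in> {c (S #> x)}" using C by simp
    qed
    ultimately show False using finite_subset by blast
  qed
  moreover have "inj_on c (rcosets S)" by (metis c inj_onI)
  ultimately show ?thesis using sg finite_imageD unfolding finite_index_subgroup_def by blast
qed

section \<open>Precompactness and finite index\<close>

lemma finite_index_imp_precompact_group:
  assumes "finite_index_subgroup S G"
  shows "precompact_group G T"
  unfolding precompact_group_def
proof (intro allI impI)
  fix U assume "neighbourhood_in T \<one> U"
  then obtain x where x: "x \<in> S" "x <# S \<subseteq> U" and U: "U \<subseteq> carrier G"
    unfolding neighbourhood_in_def openin_T by fastforce
  have sg: "subgroup S G" and fin: "finite (rcosets S)"
    using assms by (auto simp: finite_index_subgroup_def)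
  \<comment> \<open>As \<open>x\<close> is invertible within \<open>S\<close>, its coset is all of
    \<open>S\<close>; thus every neighbourhood of \<open>\<one>\<close> contains \<open>S\<close>,
    and coset representatives can serve as \<open>F\<close>.\<close>
  have SU: "S \<subseteq> U"
  proof
    fix s assume s: "s \<in> S"
    then have "inv x \<otimes> s \<in> S" using x(1) sg by (simp add: subgroup.m_inv_closed)
    then show "s \<in> U" using x s by (auto simp: mem_l_coset_iff)
  qed
  have "rcosets S = (\<lambda>a. S #> a) ` carrier G" by (auto simp: RCOSETS_def)
  then obtain F where F: "F \<subseteq> carrier G" "finite F" "rcosets S = (\<lambda>a. S #> a) ` F"
    using fin finite_subset_image by (metis subset_refl)
  have "F <#> U = carrier G"
  proof
    show "F <#> U \<subseteq> carrier G" using F(1) U by (rule set_mult_closed)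
    show "carrier G \<subseteq> F <#> U"
    proof
      fix g assume g: "g \<in> carrier G"
      then have "S #> g \<in> rcosets S" by (auto simp: RCOSETS_def)
      then obtain a where a: "a \<in> F" "S #> g = S #> a" using F(3) by auto
      then have "g \<in> a <# S" using g rcos_self[OF g sg] F(1) r_coset_eq_l_coset by auto
      then show "g \<in> F <#> U" using a(1) SU by (auto simp: l_coset_def set_mult_def)
    qed
  qed
  then show "\<exists>F. finite F \<and> F \<subseteq> carrier G \<and> F <#> U = carrier G" using F by blast
qed

text \<open>As with ordinary fractions, the product of the individual denominators works: the
  surplus factors stay in \<open>S\<close>.\<close>

lemma common_denominator:
  assumes "finite F" and "\<And>f. f \<in> F \<Longrightarrow> f \<in> carrier G \<and> (\<exists>b\<in>S. f \<otimes> b \<in> S)"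
  shows "\<exists>b\<in>S. \<forall>f\<in>F. f \<otimes> b \<in> S"
  using assms
proof (induction F rule: finite_induct)
  case empty
  then show ?case using S.one_closed by blast
next
  case (insert f F)
  obtain a where a: "a \<in> S" "f \<otimes> a \<in> S" using insert.prems by blast
  obtain b where b: "b \<in> S" "\<forall>h\<in>F. h \<otimes> b \<in> S" using insert by blast
  have "h \<otimes> (a \<otimes> b) \<in> S" if "h \<in> insert f F" for h
  proof (cases "h = f")
    case True
    then have "h \<otimes> (a \<otimes> b) = (f \<otimes> a) \<otimes> b" using insert.prems a b by (simp add: m_assoc)
    then show ?thesis using a b by simp
  next
    case False
    then have "h \<otimes> (a \<otimes> b) = a \<otimes> (h \<otimes> b)" using that insert.prems a b by (simp add: m_lcomm)
    then show ?thesis using False that a b by simp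
  qed
  then show ?case using a b by (meson S.m_closed)
qed

lemma precompact_group_imp_finite_index:
  assumes pc: "precompact_group G T"
  shows "finite_index_subgroup S G"
proof -
  have "openin T S" using openin_l_coset[OF one_closed] by (simp add: lcos_mult_one S.subset)
  then have "neighbourhood_in T \<one> S" by (intro neighbourhood_in_openin) auto
  then obtain F where F: "finite F" "F \<subseteq> carrier G" "F <#> S = carrier G"
    using pc unfolding precompact_group_def by blast
  have cover: "\<exists>f\<in>F. \<exists>t\<in>S. g = f \<otimes> t" if "g \<in> carrier G" for g
    using that unfolding F(3)[symmetric] set_mult_def by blast
  \<comment> \<open>Only those elements of \<open>F\<close> that are fractions over \<open>S\<close>
    can be given a denominator; one \<open>b\<close> serves for all of them.\<close>
  have "\<exists>b\<in>S. \<forall>f\<in>{f \<in> F. \<exists>b\<in>S. f \<otimes> b \<in> S}. f \<otimes> b \<in> S"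
    by (rule common_denominator) (use F in auto)
  then obtain b where b: "b \<in> S" "\<And>f a. \<lbrakk>f \<in> F; a \<in> S; f \<otimes> a \<in> S\<rbrakk> \<Longrightarrow> f \<otimes> b \<in> S"
    by blast
  have sg: "subgroup S G"
  proof (rule subgroup_if_inv_closed)
    fix s assume s: "s \<in> S"
    \<comment> \<open>The extra factor \<open>b\<close> is chosen in advance to clear the
      denominator of \<open>f\<close>. From \<open>?g = f \<otimes> t\<close> it follows that
      \<open>f\<close> is a fraction with denominator \<open>t \<otimes> (s \<otimes> b)\<close>, so
      \<open>f \<otimes> b\<close> is in \<open>S\<close>, and \<open>inv s\<close> is its product
      with \<open>t\<close>.\<close>
    let ?g = "inv (s \<otimes> b)"
    have g: "?g \<in> carrier G" using s b by simp
    then obtain f t where f: "f \<in> F" "t \<in> S" "?g = f \<otimes> t" using cover by blast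
    have c: "f \<in> carrier G" "s \<in> carrier G" "b \<in> carrier G" "t \<in> carrier G"
      using f F(2) s b by auto
    have "f \<otimes> (t \<otimes> (s \<otimes> b)) = ?g \<otimes> (s \<otimes> b)" using c f(3) by (simp add: m_assoc)
    also have "\<dots> = \<one>" using c by simp
    finally have "f \<otimes> (t \<otimes> (s \<otimes> b)) \<in> S" using S.one_closed by simp
    moreover have "t \<otimes> (s \<otimes> b) \<in> S" using f(2) s b(1) by simp
    ultimately have fb: "f \<otimes> b \<in> S" using b(2) f(1) by blast
    have "inv s = ?g \<otimes> b" using c by (simp add: inv_mult m_assoc)
    also have "\<dots> = (f \<otimes> b) \<otimes> t" using c f(3) by (simp add: m_ac)
    finally show "inv s \<in> S" using fb f(2) by simp
  qed
  have "rcosets S \<subseteq> (\<lambda>a. S #> a) ` F"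
  proof
    fix C assume "C \<in> rcosets S"
    then obtain g where g: "g \<in> carrier G" "C = S #> g" by (auto simp: RCOSETS_def)
    obtain f t where f: "f \<in> F" "t \<in> S" "g = f \<otimes> t" using cover[OF g(1)] by blast
    have fc: "f \<in> carrier G" using f(1) F(2) by blast
    have "g \<in> S #> f" unfolding r_coset_eq_l_coset[OF fc] using f by (auto simp: l_coset_def)
    then have "C = S #> f" using repr_independence[OF _ fc sg] g(2) by simp
    then show "C \<in> (\<lambda>a. S #> a) ` F" using f(1) by blast
  qed
  then show ?thesis using sg F(1) finite_surj unfolding finite_index_subgroup_def by blast
qed

section \<open>From a subgroup of finite index to compactness and sequential compactness\<close>

lemma openin_subgroup_l_coset:
  assumes sg: "subgroup S G" and U: "openin T U" "u \<in> U"
  shows "u <# S \<subseteq> U"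
proof
  fix z assume z: "z \<in> u <# S"
  obtain x where x: "x \<in> S" "(u \<otimes> x) <# S \<subseteq> U" and uc: "u \<in> carrier G"
    using U unfolding openin_T by blast
  have "inv x \<in> S" using sg x(1) by (simp add: subgroup.m_inv_closed)
  moreover have "inv u \<otimes> z \<in> S" "z \<in> carrier G" using z uc by (auto simp: mem_l_coset_iff)
  \<comment> \<open>The shift by \<open>x\<close> is undone inside \<open>S\<close>, so the shifted
    coset already contains the whole coset of \<open>u\<close>.\<close>
  moreover have "inv (u \<otimes> x) \<otimes> z = inv x \<otimes> (inv u \<otimes> z)"
    using uc x(1) \<open>z \<in> carrier G\<close> by (simp add: inv_mult m_ac)
  ultimately show "z \<in> U" using x uc by (auto simp: mem_l_coset_iff)
qed

lemma finite_index_imp_compact_space: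
  assumes "finite_index_subgroup S G"
  shows "compact_space T"
proof (rule finite_opens_imp_compact_space)
  have sg: "subgroup S G" and fin: "finite (rcosets S)"
    using assms by (auto simp: finite_index_subgroup_def)
  \<comment> \<open>An open set is the union of the cosets of its points, and a finite set of cosets
    has finitely many subsets.\<close>
  have "U \<in> Union ` Pow (rcosets S)" if U: "openin T U" for U
  proof
    have Uc: "U \<subseteq> carrier G" using U openin_T by blast
    then show "(\<lambda>u. S #> u) ` U \<in> Pow (rcosets S)" by (auto simp: RCOSETS_def)
    have "u \<in> S #> u" "S #> u \<subseteq> U" if "u \<in> U" for u
    proof -
      have u: "u \<in> carrier G" using that Uc by blast
      show "u \<in> S #> u" using rcos_self[OF u sg] .
      show "S #> u \<subseteq> U" using openin_subgroup_l_coset[OF sg U that] r_coset_eq_l_coset[OF u] by simp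
    qed
    then show "U = \<Union> ((\<lambda>u. S #> u) ` U)" by blast
  qed
  then have "{U. openin T U} \<subseteq> Union ` Pow (rcosets S)" by blast
  then show "finite {U. openin T U}" by (rule finite_subset) (simp add: fin)
qed

lemma finite_index_imp_sequentially_compact_space:
  assumes "finite_index_subgroup S G"
  shows "sequentially_compact_space T"
  unfolding sequentially_compact_space_def
proof (intro allI impI)
  fix \<sigma> :: "nat \<Rightarrow> 'a"
  assume "range \<sigma> \<subseteq> topspace T"
  then have \<sigma>: "\<sigma> n \<in> carrier G" for n by auto
  have sg: "subgroup S G" and fin: "finite (rcosets S)"
    using assms by (auto simp: finite_index_subgroup_def)
  have "finite (range (\<lambda>n. S #> \<sigma> n))"
    by (rule finite_subset[OF _ fin]) (use \<sigma> in \<open>auto simp: RCOSETS_def\<close>)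
  \<comment> \<open>By the pigeonhole principle one coset receives infinitely many terms. An open
    set around \<open>\<sigma> k\<close> contains that coset, so the subsequence lies in it from the
    start and any \<open>N\<close> works.\<close>
  then obtain k where k: "infinite {n. S #> \<sigma> n = S #> \<sigma> k}"
    using pigeonhole_infinite[OF infinite_UNIV_nat] by auto
  let ?I = "{n. S #> \<sigma> n = S #> \<sigma> k}"
  have "limitin T (\<sigma> \<circ> enumerate ?I) (\<sigma> k) sequentially"
    unfolding limitin_sequentially
  proof (intro conjI allI impI)
    show "\<sigma> k \<in> topspace T" using \<sigma> by simp
    fix U assume U: "openin T U \<and> \<sigma> k \<in> U"
    have "(\<sigma> \<circ> enumerate ?I) n \<in> U" for n
    proof -
      have "S #> \<sigma> (enumerate ?I n) = S #> \<sigma> k" using enumerate_in_set[OF k, of n] by simp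
      then have "\<sigma> (enumerate ?I n) \<in> \<sigma> k <# S"
        using rcos_self[OF \<sigma> sg] r_coset_eq_l_coset[OF \<sigma>] by metis
      then show ?thesis using openin_subgroup_l_coset[OF sg] U by auto
    qed
    then show "\<exists>N. \<forall>n\<ge>N. (\<sigma> \<circ> enumerate ?I) n \<in> U" by blast
  qed
  then show "\<exists>(r :: nat \<Rightarrow> nat) l. strict_mono r \<and> limitin T (\<sigma> \<circ> r) l sequentially"
    using strict_mono_enumerate[OF k] by blast
qed

end

theorem proposition5p16:
  fixes G :: "('a, 'b) monoid_scheme" and S :: "'a set"
  assumes "comm_group G" and "submonoid S G"
  shows "(compact_space (shift_topology G S)
            \<longleftrightarrow> omega_bounded_space (shift_topology G S)) \<and>
         (omega_bounded_space (shift_topology G S)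
            \<longleftrightarrow> totally_countably_compact_space (shift_topology G S)) \<and>
         (totally_countably_compact_space (shift_topology G S)
            \<longleftrightarrow> sequentially_compact_space (shift_topology G S)) \<and>
         (sequentially_compact_space (shift_topology G S)
            \<longleftrightarrow> countably_compact_space (shift_topology G S)) \<and>
         (countably_compact_space (shift_topology G S)
            \<longleftrightarrow> precompact_group G (shift_topology G S)) \<and>
         (precompact_group G (shift_topology G S)
            \<longleftrightarrow> finite_index_subgroup S G)"
proof -
  interpret shift_space G S
    using assms by (simp add: shift_space_def)
  \<comment> \<open>Each condition leads to finite index, through countable compactness or
    precompactness; finite index gives back compactness, sequential compactness and
    precompactness.\<close>
  show ?thesis
    using compact_space_imp_omega_bounded_space omega_bounded_space_imp_totally_countably_compact_space
      totally_countably_compact_space_imp_countably_compact_space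
      sequentially_compact_space_imp_countably_compact_space
      countably_compact_space_imp_finite_index precompact_group_imp_finite_index
      finite_index_imp_compact_space finite_index_imp_sequentially_compact_space
      finite_index_imp_precompact_group
    by metis
qed

end
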